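(* Let $Q(n_1,n_2,n_3)=\frac{n_1^2}{2}+3n_2^2+\frac{9n_3^2}{2}+2n_1n_2+6n_2n_3+3n_1n_3$ and define $$F_1(x)=\cdots=F_6(x)=\sum_{n_1,n_2,n_3\ge 0}\frac{q^{Q(n_1,n_2,n_3)+\frac{n_1}{2}-n_2-\frac{n_3}{2}}x^{n_1+2n_2+3n_3}}{(q;q)_{n_1}(q^2;q^2)_{n_2}(q^3;q^3)_{n_3}},$$ $$F_7(x)=\cdots=F_{13}(x)=\sum_{n_1,n_2,n_3\ge 0}\frac{q^{Q(n_1,n_2,n_3)+\frac{3n_1}{2}+n_2+\frac{5n_3}{2}}x^{n_1+2n_2+3n_3}}{(q;q)_{n_1}(q^2;q^2)_{n_2}(q^3;q^3)_{n_3}},$$ $$F_{14}(x)=\cdots=F_{21}(x)=\sum_{n_1,n_2,n_3\ge 0}\frac{q^{Q(n_1,n_2,n_3)+\frac{3n_1}{2}+3n_2+\frac{11n_3}{2}}x^{n_1+2n_2+3n_3}}{(q;q)_{n_1}(q^2;q^2)_{n_2}(q^3;q^3)_{n_3}},$$ $$F_{22}(x)=F_{23}(x)=\sum_{n_1,n_2,n_3\ge 0}\frac{q^{Q(n_1,n_2,n_3)+\frac{5n_1}{2}+3n_2+\frac{11n_3}{2}}x^{n_1+2n_2+3n_3}}{(q;q)_{n_1}(q^2;q^2)_{n_2}(q^3;q^3)_{n_3}}.$$ Let $\mathscr{A}$ be the $23\times 23$ $(0,1)$-matrix whose $i$-th row has entry $1$ exactly in the columns listed below and $0$ elsewhere: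 rows $1$–$6$: all columns $1,\ldots,23$; rows $7$–$13$: columns $\{1,2,7,8,9,10,14,15,16,17,22\}$; rows $14$–$21$: columns $\{1,2,7,8,14,15,16,22\}$; rows $22$–$23$: columns $\{1,7,14,15,22\}$. Let $$\mathscr{W}(x)=\operatorname{diag}\big(1,xq^2,xq,x^2q^3,x^2q^2,x^3q^4,\ xq^3,x^2q^5,x^2q^4,x^3q^7,x^2q^4,x^3q^6,x^3q^5,\ x^2q^7,x^2q^6,x^3q^9,x^3q^8,x^3q^8,x^3q^7,x^4q^{10},x^4q^9,\ x^3q^{10},x^4q^{11}\big).$$ Then $$\begin{pmatrix}F_1(x)\\ \vdots\\ F_{23}(x)\end{pmatrix}=\mathscr{A}\,\mathscr{W}(x)\begin{pmatrix}F_1(xq^3)\\ \vdots\\ F_{23}(xq^3)\end{pmatrix}.$$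
   Context: $(a;q)_n=\prod_{j=0}^{n-1}(1-aq^j)$. The exponents of $q$ in the summands are non-negative integers for all $n_1,n_2,n_3\ge 0$. The identity is between formal power series in $x$ and $q$ (equivalently, analytic functions for $|q|<1$). *)

theory Defs
  imports
    "HOL-Analysis.Infinite_Sum"
    "HOL-Computational_Algebra.Formal_Power_Series"
    "Jordan_Normal_Form.Matrix"
begin

text \<open>
  Formal power series in \<open>x\<close> and \<open>q\<close> over a field are elements of \<^typ>\<open>'a fps fps\<close>: the outer
  variable \<open>fps_X\<close> is \<open>x\<close>, and the variable of the coefficient ring
  \<^typ>\<open>'a fps\<close> is \<open>q\<close>.
\<close>

definition q_var :: "'a::field fps fps" where
  "q_var = fps_const fps_X"

text \<open>The finite \<open>q\<close>-Pochhammer symbol \<open>(a; q)\<^sub>n\<close>.\<close>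

definition qpoch :: "'a::comm_ring_1 \<Rightarrow> 'a \<Rightarrow> nat \<Rightarrow> 'a" where
  "qpoch a q n = (\<Prod>j<n. 1 - a * q ^ j)"

definition Q :: "nat \<Rightarrow> nat \<Rightarrow> nat \<Rightarrow> rat" where
  "Q n1 n2 n3 = of_nat n1 ^ 2 / 2 + 3 * of_nat n2 ^ 2 + 9 * of_nat n3 ^ 2 / 2
     + 2 * of_nat n1 * of_nat n2 + 6 * of_nat n2 * of_nat n3 + 3 * of_nat n1 * of_nat n3"

fun lin_form :: "rat \<times> rat \<times> rat \<Rightarrow> nat \<Rightarrow> nat \<Rightarrow> nat \<Rightarrow> rat" where
  "lin_form (a, b, c) n1 n2 n3 = a * of_nat n1 + b * of_nat n2 + c * of_nat n3"

definition lin_coeffs :: "nat \<Rightarrow> rat \<times> rat \<times> rat" where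
  "lin_coeffs i =
     (if i \<in> {1..6} then (1/2, -1, -1/2)
      else if i \<in> {7..13} then (3/2, 1, 5/2)
      else if i \<in> {14..21} then (3/2, 3, 11/2)
      else (5/2, 3, 11/2))"

text \<open>
  The rounding below is exact, since the rational exponent is always a non-negative integer; see
  \<open>of_nat_q_exponent\<close>.
\<close>

definition q_exponent :: "nat \<Rightarrow> nat \<Rightarrow> nat \<Rightarrow> nat \<Rightarrow> nat" where
  "q_exponent i n1 n2 n3 = nat \<lfloor>Q n1 n2 n3 + lin_form (lin_coeffs i) n1 n2 n3\<rfloor>"

text \<open>
  The denominator has constant term 1, hence is a unit, so this is genuine division.
\<close>

definition F_coeff :: "nat \<Rightarrow> nat \<Rightarrow> nat \<Rightarrow> nat \<Rightarrow> 'a::field fps" where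
  "F_coeff i n1 n2 n3 = fps_X ^ q_exponent i n1 n2 n3 /
     (qpoch fps_X fps_X n1 * qpoch (fps_X ^ 2) (fps_X ^ 2) n2 * qpoch (fps_X ^ 3) (fps_X ^ 3) n3)"

text \<open>
  The triple sum is taken in the \<open>x\<close>-adic topology of \<^typ>\<open>'a fps fps\<close>. It converges for
  \<open>x = fps_X\<close> and all its rescalings by elements of the coefficient ring; see \<open>F_summable\<close>.
\<close>

definition F :: "nat \<Rightarrow> 'a::field fps fps \<Rightarrow> 'a fps fps" where
  "F i x = (\<Sum>\<^sub>\<infinity>(n1, n2, n3)\<in>UNIV. fps_const (F_coeff i n1 n2 n3) * x ^ (n1 + 2 * n2 + 3 * n3))"

text \<open>
  Indices in the definitions above and in \<open>A_cols\<close> run from 1 to 23, whereas matrices and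
  vectors are indexed from 0.
\<close>

definition F_vec :: "'a::field fps fps \<Rightarrow> 'a fps fps vec" where
  "F_vec x = vec 23 (\<lambda>i. F (i + 1) x)"

definition A_cols :: "nat \<Rightarrow> nat set" where
  "A_cols i =
     (if i \<in> {1..6} then {1..23}
      else if i \<in> {7..13} then {1, 2, 7, 8, 9, 10, 14, 15, 16, 17, 22}
      else if i \<in> {14..21} then {1, 2, 7, 8, 14, 15, 16, 22}
      else {1, 7, 14, 15, 22})"

definition A_mat :: "'a::field fps fps mat" where
  "A_mat = mat 23 23 (\<lambda>(i, j). if j + 1 \<in> A_cols (i + 1) then 1 else 0)"

definition W_mat :: "'a::field fps fps \<Rightarrow> 'a fps fps mat" where
  "W_mat x = (let q = q_var in mat_diag 23 (\<lambda>i.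
     [1, x * q^2, x * q, x^2 * q^3, x^2 * q^2, x^3 * q^4,
      x * q^3, x^2 * q^5, x^2 * q^4, x^3 * q^7, x^2 * q^4, x^3 * q^6, x^3 * q^5,
      x^2 * q^7, x^2 * q^6, x^3 * q^9, x^3 * q^8, x^3 * q^8, x^3 * q^7, x^4 * q^10, x^4 * q^9,
      x^3 * q^10, x^4 * q^11] ! i))"

lemma of_nat_q_exponent:
  "of_nat (q_exponent i n1 n2 n3) = Q n1 n2 n3 + lin_form (lin_coeffs i) n1 n2 n3"
proof -
  have tri: "\<exists>k. n * (n + 1) = 2 * k" for n :: nat
    by (metis dvdE even_mult_iff odd_even_add odd_one)
  obtain a where a: "n1 * (n1 + 1) = 2 * a" using tri by blast
  obtain c where c: "n3 * (n3 + 1) = 2 * c" using tri by blast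
  have a': "of_nat n1 ^ 2 = 2 * of_nat a - (of_nat n1 :: rat)"
    using arg_cong[OF a, of "of_nat :: nat \<Rightarrow> rat"]
    by (simp add: power2_eq_square algebra_simps)
  have c': "of_nat n3 ^ 2 = 2 * of_nat c - (of_nat n3 :: rat)"
    using arg_cong[OF c, of "of_nat :: nat \<Rightarrow> rat"]
    by (simp add: power2_eq_square algebra_simps)
  have sq: "n \<le> n ^ 2" for n :: nat
    by (simp add: power2_eq_square)
  have b0: "int n2 \<le> int n2 ^ 2"
    using sq[of n2] by (metis of_nat_le_iff of_nat_power)
  have c0: "int n3 \<le> int c"
  proof -
    have "n3 \<le> n3 * n3" by simp
    then have "2 * n3 \<le> 2 * c" using c by (simp only: distrib_left mult_1_right)
    then show ?thesis by simp
  qed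
  define m where "m = 2 * int n1 * int n2 + 6 * int n2 * int n3 + 3 * int n1 * int n3"
  have m0: "0 \<le> m" unfolding m_def by simp
  obtain z :: int where z: "Q n1 n2 n3 + lin_form (lin_coeffs i) n1 n2 n3 = of_int z" "0 \<le> z"
  proof (cases "i \<in> {1..6}")
    case True
    have "Q n1 n2 n3 + lin_form (lin_coeffs i) n1 n2 n3
      = of_int (int a + 3 * int n2 ^ 2 - int n2 + 9 * int c - 5 * int n3 + m)"
      using True by (simp add: Q_def lin_coeffs_def m_def a' c' field_simps)
    moreover have "0 \<le> int a + 3 * int n2 ^ 2 - int n2 + 9 * int c - 5 * int n3 + m"
      using b0 c0 m0 by linarith
    ultimately show ?thesis using that by blast
  next
    case F1: False
    show ?thesis
    proof (cases "i \<in> {7..13}")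
      case True
      have "Q n1 n2 n3 + lin_form (lin_coeffs i) n1 n2 n3
        = of_int (int a + int n1 + 3 * int n2 ^ 2 + int n2 + 9 * int c - 2 * int n3 + m)"
        using F1 True by (simp add: Q_def lin_coeffs_def m_def a' c' field_simps)
      moreover have "0 \<le> int a + int n1 + 3 * int n2 ^ 2 + int n2 + 9 * int c - 2 * int n3 + m"
        using b0 c0 m0 by linarith
      ultimately show ?thesis using that by blast
    next
      case F2: False
      show ?thesis
      proof (cases "i \<in> {14..21}")
        case True
        have "Q n1 n2 n3 + lin_form (lin_coeffs i) n1 n2 n3
          = of_int (int a + int n1 + 3 * int n2 ^ 2 + 3 * int n2 + 9 * int c + int n3 + m)"
          using F1 F2 True by (simp add: Q_def lin_coeffs_def m_def a' c' field_simps)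
        moreover have "0 \<le> int a + int n1 + 3 * int n2 ^ 2 + 3 * int n2 + 9 * int c + int n3 + m"
          using b0 c0 m0 by linarith
        ultimately show ?thesis using that by blast
      next
        case F3: False
        have "lin_coeffs i = (5/2, 3, 11/2)"
          unfolding lin_coeffs_def using F1 F2 F3 by presburger
        then have "Q n1 n2 n3 + lin_form (lin_coeffs i) n1 n2 n3
          = of_int (int a + 2 * int n1 + 3 * int n2 ^ 2 + 3 * int n2 + 9 * int c + int n3 + m)"
          by (simp add: Q_def m_def a' c' field_simps)
        moreover have "0 \<le> int a + 2 * int n1 + 3 * int n2 ^ 2 + 3 * int n2 + 9 * int c + int n3 + m"
          using b0 c0 m0 by linarith
        ultimately show ?thesis using that by blast
      qed
    qed
  qed
  show ?thesis
    unfolding q_exponent_def z(1) using z(2) by simp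
qed

lemma finite_F_index: "finite {(n1, n2, n3). n1 + 2 * n2 + 3 * n3 \<le> (N :: nat)}"
  by (rule finite_subset[of _ "{..N} \<times> {..N} \<times> {..N}"]) auto

lemma F_has_sum:
  fixes c :: "'a::field fps"
  shows "((\<lambda>(n1, n2, n3). fps_const (F_coeff i n1 n2 n3) * (fps_X * fps_const c) ^ (n1 + 2 * n2 + 3 * n3))
    has_sum Abs_fps (\<lambda>N. \<Sum>(n1, n2, n3)\<in>{(n1, n2, n3). n1 + 2 * n2 + 3 * n3 = N}.
      F_coeff i n1 n2 n3 * c ^ N)) UNIV"
    (is "(?f has_sum ?S) UNIV")
proof -
  have f_nth: "fps_nth (?f (n1, n2, n3)) k
      = (if n1 + 2 * n2 + 3 * n3 = k then F_coeff i n1 n2 n3 * c ^ k else 0)" for n1 n2 n3 k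
    by (auto simp: power_mult_distrib fps_const_power mult.assoc[symmetric])
  have coeff: "fps_nth (sum ?f Y) k = fps_nth ?S k"
    if Y: "finite Y" "{(n1, n2, n3). n1 + 2 * n2 + 3 * n3 \<le> N} \<subseteq> Y" and k: "k \<le> N" for Y N k
  proof -
    let ?I = "{(n1, n2, n3). n1 + 2 * n2 + 3 * n3 = k}"
    have sub: "?I \<subseteq> Y" using Y(2) k by auto
    have z: "fps_nth (?f t) k = 0" if "t \<in> Y - ?I" for t
      using that f_nth by (cases t) auto
    have "fps_nth (sum ?f Y) k = (\<Sum>t\<in>Y. fps_nth (?f t) k)"
      by (simp add: fps_sum_nth)
    also have "\<dots> = (\<Sum>t\<in>?I. fps_nth (?f t) k)"
      using Y(1) sub z by (intro sum.mono_neutral_right) auto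
    also have "\<dots> = (\<Sum>(n1, n2, n3)\<in>?I. F_coeff i n1 n2 n3 * c ^ k)"
    proof (rule sum.cong[OF refl])
      fix t assume t: "t \<in> ?I"
      obtain n1 n2 n3 where [simp]: "t = (n1, n2, n3)" by (cases t)
      show "fps_nth (?f t) k = (case t of (n1, n2, n3) \<Rightarrow> F_coeff i n1 n2 n3 * c ^ k)"
        using t f_nth[of n1 n2 n3 k] by simp
    qed
    finally show ?thesis by simp
  qed
  show ?thesis
    unfolding has_sum_def
  proof (rule tendstoI)
    fix e :: real assume "e > 0"
    then obtain N where N: "inverse (2 ^ N) < e"
      using real_arch_pow_inv[of e "1/2"] by (auto simp: power_one_over inverse_eq_divide)
    have "dist (sum ?f Y) ?S < e"
      if Y: "finite Y" "{(n1, n2, n3). n1 + 2 * n2 + 3 * n3 \<le> N} \<subseteq> Y" for Y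
      using nth_equal_imp_dist_less[of N "sum ?f Y" ?S] coeff[OF Y] N by fastforce
    then show "\<forall>\<^sub>F Y in finite_subsets_at_top UNIV. dist (sum ?f Y) ?S < e"
      unfolding eventually_finite_subsets_at_top
      using finite_F_index[of N] by blast
  qed
qed

lemma F_summable:
  fixes c :: "'a::field fps"
  shows "(\<lambda>(n1, n2, n3). fps_const (F_coeff i n1 n2 n3) * (fps_X * fps_const c) ^ (n1 + 2 * n2 + 3 * n3))
    summable_on UNIV"
  using F_has_sum unfolding summable_on_def by blast

lemma F_nth:
  fixes c :: "'a::field fps"
  shows "fps_nth (F i (fps_X * fps_const c)) N
    = (\<Sum>(n1, n2, n3)\<in>{(n1, n2, n3). n1 + 2 * n2 + 3 * n3 = N}. F_coeff i n1 n2 n3 * c ^ N)"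
  unfolding F_def infsumI[OF F_has_sum] by simp

end

theory Submission
  imports Defs
begin

text \<open>
  Multiply the \<open>(n\<^sub>1, n\<^sub>2, n\<^sub>3)\<close>-summand of \<open>F\<^sub>1(x)\<close> by \<open>q ^ (a n\<^sub>1 + b n\<^sub>2 + c n\<^sub>3)\<close>
  and call the sum \<open>S(a, b, c)\<close>. All the series in the theorem are of this form: \<open>F\<^sub>1\<close>, \<open>F\<^sub>7\<close>, \<open>F\<^sub>1\<^sub>4\<close>, \<open>F\<^sub>2\<^sub>2\<close> have \<open>(a, b, c)\<close> equal to \<open>(0, 0, 0)\<close>,
  \<open>(1, 2, 3)\<close>, \<open>(1, 4, 6)\<close>, \<open>(2, 4, 6)\<close>, and replacing \<open>x\<close> by \<open>x q\<^sup>3\<close> adds \<open>(3, 6, 9)\<close>. Cancelling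
  the last factor of one of the three \<open>q\<close>-Pochhammer symbols and shifting the corresponding summation
  index gives three contiguous relations, for instance
  \<open>S(a, b, c) - S(a + 1, b, c) = x q\<^sup>a\<^sup>+\<^sup>1 S(a + 1, b + 2, c + 3)\<close>. Each of the four distinct rows of the
  matrix identity is a linear combination of finitely many instances of these relations.
\<close>

section \<open>Iterating the contiguous relations\<close>

text \<open>Over an abstract \<open>S\<close> only polynomial algebra in \<open>x\<close> and
  \<open>q\<close> remains. The index triples on the right are the four triples named above shifted
  by (3, 6, 9). Summands follow the column order of the matrix and equal ones stay separate, so each
  summand is one column.\<close>

lemma contiguous_relations_iterated:
  fixes S :: "nat \<Rightarrow> nat \<Rightarrow> nat \<Rightarrow> 'a::idom" and x q :: 'a
  assumes step1: "\<And>a b c. S a b c = S (a + 1) b c + x * q ^ (a + 1) * S (a + 1) (b + 2) (c + 3)"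
    and step2: "\<And>a b c. S a b c = S a (b + 2) c + x\<^sup>2 * q ^ (b + 2) * S (a + 2) (b + 6) (c + 6)"
    and step3: "\<And>a b c. S a b c = S a b (c + 3) + x ^ 3 * q ^ (c + 4) * S (a + 3) (b + 6) (c + 9)"
  shows "S 2 4 6 =
      S 3 6 9 + x * q^3 * S 4 8 12 + x^2 * q^7 * S 4 10 15 + x^2 * q^6 * S 4 10 15
      + x^3 * q^10 * S 5 10 15"
    and "S 1 4 6 =
      S 3 6 9 + x * q^2 * S 3 6 9 + x * q^3 * S 4 8 12 + x^2 * q^5 * S 4 8 12
      + x^2 * q^7 * S 4 10 15 + x^2 * q^6 * S 4 10 15 + x^3 * q^9 * S 4 10 15
      + x^3 * q^10 * S 5 10 15"
    and "S 1 2 3 =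
      S 3 6 9 + x * q^2 * S 3 6 9 + x * q^3 * S 4 8 12 + x^2 * q^5 * S 4 8 12
      + x^2 * q^4 * S 4 8 12 + x^3 * q^7 * S 4 8 12 + x^2 * q^7 * S 4 10 15
      + x^2 * q^6 * S 4 10 15 + x^3 * q^9 * S 4 10 15 + x^3 * q^8 * S 4 10 15
      + x^3 * q^10 * S 5 10 15"
    and "S 0 0 0 =
      S 3 6 9 + x * q^2 * S 3 6 9 + x * q * S 3 6 9 + x^2 * q^3 * S 3 6 9
      + x^2 * q^2 * S 3 6 9 + x^3 * q^4 * S 3 6 9 + x * q^3 * S 4 8 12
      + x^2 * q^5 * S 4 8 12 + x^2 * q^4 * S 4 8 12 + x^3 * q^7 * S 4 8 12
      + x^2 * q^4 * S 4 8 12 + x^3 * q^6 * S 4 8 12 + x^3 * q^5 * S 4 8 12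
      + x^2 * q^7 * S 4 10 15 + x^2 * q^6 * S 4 10 15 + x^3 * q^9 * S 4 10 15
      + x^3 * q^8 * S 4 10 15 + x^3 * q^8 * S 4 10 15 + x^3 * q^7 * S 4 10 15
      + x^4 * q^10 * S 4 10 15 + x^4 * q^9 * S 4 10 15 + x^3 * q^10 * S 5 10 15
      + x^4 * q^11 * S 5 10 15"
proof -
  \<comment> \<open>The plain name \<open>algebra\<close> would refer to the method of HOL-Algebra here.\<close>
  have r246: "S 2 4 6 = S 2 4 9 + x^3 * q^10 * S 5 10 15"
    using step3[of 2 4 6] by (simp del: One_nat_def add_2_eq_Suc')
  have r249: "S 2 4 9 = S 2 6 9 + x^2 * q^6 * S 4 10 15"
    using step2[of 2 4 9] by (simp del: One_nat_def add_2_eq_Suc')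
  have r269: "S 2 6 9 = S 3 6 9 + x * q^3 * S 3 8 12"
    using step1[of 2 6 9] by (simp del: One_nat_def add_2_eq_Suc')
  have r3812: "S 3 8 12 = S 4 8 12 + x * q^4 * S 4 10 15"
    using step1[of 3 8 12] by (simp del: One_nat_def add_2_eq_Suc')
  show S246: "S 2 4 6 =
      S 3 6 9 + x * q^3 * S 4 8 12 + x^2 * q^7 * S 4 10 15 + x^2 * q^6 * S 4 10 15
      + x^3 * q^10 * S 5 10 15"
    unfolding r246 r249 r269 r3812 by Groebner_Basis.algebra
  have r146: "S 1 4 6 = S 2 4 6 + x * q^2 * S 2 6 9"
    using step1[of 1 4 6] by (simp del: One_nat_def add_2_eq_Suc')
  show S146: "S 1 4 6 =
      S 3 6 9 + x * q^2 * S 3 6 9 + x * q^3 * S 4 8 12 + x^2 * q^5 * S 4 8 12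
      + x^2 * q^7 * S 4 10 15 + x^2 * q^6 * S 4 10 15 + x^3 * q^9 * S 4 10 15
      + x^3 * q^10 * S 5 10 15"
    unfolding r146 S246 r269 r3812 by Groebner_Basis.algebra
  have r123: "S 1 2 3 = S 1 2 6 + x^3 * q^7 * S 4 8 12"
    using step3[of 1 2 3] by (simp del: One_nat_def add_2_eq_Suc')
  have r126: "S 1 2 6 = S 1 4 6 + x^2 * q^4 * S 3 8 12"
    using step2[of 1 2 6] by (simp del: One_nat_def add_2_eq_Suc')
  show S123: "S 1 2 3 =
      S 3 6 9 + x * q^2 * S 3 6 9 + x * q^3 * S 4 8 12 + x^2 * q^5 * S 4 8 12
      + x^2 * q^4 * S 4 8 12 + x^3 * q^7 * S 4 8 12 + x^2 * q^7 * S 4 10 15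
      + x^2 * q^6 * S 4 10 15 + x^3 * q^9 * S 4 10 15 + x^3 * q^8 * S 4 10 15
      + x^3 * q^10 * S 5 10 15"
    unfolding r123 r126 S146 r3812 by Groebner_Basis.algebra
  have r000: "S 0 0 0 = S 0 0 3 + x^3 * q^4 * S 3 6 9"
    using step3[of 0 0 0] by (simp del: One_nat_def add_2_eq_Suc')
  have r003: "S 0 0 3 = S 0 0 6 + x^3 * q^7 * S 3 6 12"
    using step3[of 0 0 3] by (simp del: One_nat_def add_2_eq_Suc')
  have r006: "S 0 0 6 = S 1 0 6 + x * q * S 1 2 9"
    using step1[of 0 0 6] by (simp del: One_nat_def add_2_eq_Suc')
  \<comment> \<open>\<open>step3\<close> is read backwards here and in \<open>r129\<close>. The
    negative terms x^3 q^7 S 4 6 12 and x^4 q^11 S 4 8 15 that result cancel the two parts into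
    which \<open>r3612\<close> splits x^3 q^7 S 3 6 12.\<close>
  have r106: "S 1 0 6 = S 1 0 3 - x^3 * q^7 * S 4 6 12"
    using step3[of 1 0 3] by (simp del: One_nat_def add_2_eq_Suc')
  have r103: "S 1 0 3 = S 1 2 3 + x^2 * q^2 * S 3 6 9"
    using step2[of 1 0 3] by (simp del: One_nat_def add_2_eq_Suc')
  have r129: "S 1 2 9 = S 1 2 6 - x^3 * q^10 * S 4 8 15"
    using step3[of 1 2 6] by (simp del: One_nat_def add_2_eq_Suc')
  have r126': "S 1 2 6 = S 2 2 6 + x * q^2 * S 2 4 9"
    using step1[of 1 2 6] by (simp del: One_nat_def add_2_eq_Suc')
  have r226: "S 2 2 6 = S 2 4 6 + x^2 * q^4 * S 4 8 12"
    using step2[of 2 2 6] by (simp del: One_nat_def add_2_eq_Suc')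
  have r3612: "S 3 6 12 = S 4 6 12 + x * q^4 * S 4 8 15"
    using step1[of 3 6 12] by (simp del: One_nat_def add_2_eq_Suc')
  show "S 0 0 0 =
      S 3 6 9 + x * q^2 * S 3 6 9 + x * q * S 3 6 9 + x^2 * q^3 * S 3 6 9
      + x^2 * q^2 * S 3 6 9 + x^3 * q^4 * S 3 6 9 + x * q^3 * S 4 8 12
      + x^2 * q^5 * S 4 8 12 + x^2 * q^4 * S 4 8 12 + x^3 * q^7 * S 4 8 12
      + x^2 * q^4 * S 4 8 12 + x^3 * q^6 * S 4 8 12 + x^3 * q^5 * S 4 8 12
      + x^2 * q^7 * S 4 10 15 + x^2 * q^6 * S 4 10 15 + x^3 * q^9 * S 4 10 15
      + x^3 * q^8 * S 4 10 15 + x^3 * q^8 * S 4 10 15 + x^3 * q^7 * S 4 10 15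
      + x^4 * q^10 * S 4 10 15 + x^4 * q^9 * S 4 10 15 + x^3 * q^10 * S 5 10 15
      + x^4 * q^11 * S 5 10 15"
    unfolding r000 r003 r006 r106 r103 r129 r126' r226 r3612
      S123 S246 r249 r269 r3812 by Groebner_Basis.algebra
qed

section \<open>Generating functions over index triples\<close>

definition triples :: "nat \<Rightarrow> (nat \<times> nat \<times> nat) set" where
  "triples N = {(n1, n2, n3). n1 + 2 * n2 + 3 * n3 = N}"

lemma mem_triples [simp]: "(n1, n2, n3) \<in> triples N \<longleftrightarrow> n1 + 2 * n2 + 3 * n3 = N"
  by (simp add: triples_def)

lemma finite_triples [simp]: "finite (triples N)"
  by (rule finite_subset[OF _ finite_F_index[of N]]) (auto simp: triples_def)

text \<open>The formal sum of f n1 n2 n3 x^(n1 + 2 n2 + 3 n3), encoded by its coefficients, which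
  are finite sums, so that no convergence argument is needed.\<close>

definition triple_gf :: "(nat \<Rightarrow> nat \<Rightarrow> nat \<Rightarrow> 'a::comm_ring_1) \<Rightarrow> 'a fps" where
  "triple_gf f = Abs_fps (\<lambda>N. \<Sum>(n1, n2, n3)\<in>triples N. f n1 n2 n3)"

lemma triple_gf_nth: "fps_nth (triple_gf f) N = (\<Sum>(n1, n2, n3)\<in>triples N. f n1 n2 n3)"
  by (simp add: triple_gf_def)

text \<open>By \<open>supp\<close>, the difference of \<open>f\<close> and \<open>g\<close> lives on
  indices of size at least (k1, k2, k3). Shifting the summation indices down by this amount pulls
  out the power of x.\<close>

lemma triple_gf_eq_add_shift:
  assumes supp: "\<And>n1 n2 n3. \<not> (k1 \<le> n1 \<and> k2 \<le> n2 \<and> k3 \<le> n3) \<Longrightarrow> f n1 n2 n3 = g n1 n2 n3"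
    and shift: "\<And>n1 n2 n3. f (n1 + k1) (n2 + k2) (n3 + k3) - g (n1 + k1) (n2 + k2) (n3 + k3)
      = w * h n1 n2 n3"
  shows "triple_gf f = triple_gf g + fps_X ^ (k1 + 2 * k2 + 3 * k3) * fps_const w * triple_gf h"
proof (rule fps_ext)
  fix N
  let ?k = "k1 + 2 * k2 + 3 * k3"
  let ?d = "\<lambda>(n1, n2, n3). f n1 n2 n3 - g n1 n2 n3"
  let ?s = "\<lambda>(n1, n2, n3). (n1 + k1, n2 + k2, n3 + k3)"
  let ?J = "{(n1, n2, n3) \<in> triples N. k1 \<le> n1 \<and> k2 \<le> n2 \<and> k3 \<le> n3}"
  have "fps_nth (triple_gf f) N - fps_nth (triple_gf g) N = sum ?d (triples N)"
    by (simp add: triple_gf_nth sum_subtractf case_prod_unfold)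
  also have "\<dots> = sum ?d ?J"
    by (rule sum.mono_neutral_right) (auto, (metis supp)+)
  also have "\<dots> = (if N < ?k then 0 else w * fps_nth (triple_gf h) (N - ?k))"
  proof (cases "N < ?k")
    case True
    then have "?J = {}"
      by (auto simp: triples_def)
    then show ?thesis using True by (simp only: sum.empty if_True)
  next
    case False
    have "sum ?d ?J = sum (\<lambda>(n1, n2, n3). w * h n1 n2 n3) (triples (N - ?k))"
    \<comment> \<open>The truncated subtraction is exact because \<open>?J\<close> forces each index
      to be at least its shift.\<close>
    proof (rule sum.reindex_bij_witness[of _ ?s "\<lambda>(n1, n2, n3). (n1 - k1, n2 - k2, n3 - k3)"])
    qed (use False in \<open>auto simp: shift[symmetric] algebra_simps\<close>)
    then show ?thesis
      using False by (simp add: triple_gf_nth sum_distrib_left case_prod_unfold)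
  qed
  finally show "fps_nth (triple_gf f) N
    = fps_nth (triple_gf g + fps_X ^ ?k * fps_const w * triple_gf h) N"
    by (simp add: fps_X_power_mult_nth mult.assoc diff_eq_eq add.commute)
qed

section \<open>Coefficients under unit steps of the indices\<close>

lemma qpoch_Suc: "qpoch a q (Suc n) = qpoch a q n * (1 - a * q ^ n)"
  by (simp add: qpoch_def mult.commute)

lemma qpoch_fps_X_nth_0 [simp]:
  "k > 0 \<Longrightarrow> fps_nth (qpoch (fps_X ^ k) (fps_X ^ k :: 'a::field fps) n) 0 = 1"
  by (induction n) (simp_all add: qpoch_Suc, simp add: qpoch_def)

definition denom :: "nat \<Rightarrow> nat \<Rightarrow> nat \<Rightarrow> 'a::field fps" where
  "denom n1 n2 n3 =
     qpoch fps_X fps_X n1 * qpoch (fps_X ^ 2) (fps_X ^ 2) n2 * qpoch (fps_X ^ 3) (fps_X ^ 3) n3"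

lemma denom_nth_0: "fps_nth (denom n1 n2 n3 :: 'a::field fps) 0 = 1"
  using qpoch_fps_X_nth_0[of 1 n1, where ?'a = 'a] by (simp add: denom_def)

lemma denom_nonzero: "denom n1 n2 n3 \<noteq> (0 :: 'a::field fps)"
  using denom_nth_0[of n1 n2 n3, where ?'a = 'a] by auto

text \<open>The denominator is a unit, having constant term 1. Later arguments can thus clear it and
  avoid division.\<close>

lemma F_coeff_times_denom:
  "F_coeff i n1 n2 n3 * denom n1 n2 n3 = (fps_X ^ q_exponent i n1 n2 n3 :: 'a::field fps)"
  using denom_nth_0[of n1 n2 n3, where ?'a = 'a]
  unfolding F_coeff_def denom_def[symmetric]
  by (simp add: fps_divide_unit mult.assoc inverse_mult_eq_1)

lemma denom_Suc:
  "denom (Suc n1) n2 n3 = denom n1 n2 n3 * (1 - fps_X ^ (n1 + 1) :: 'a::field fps)"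
  "denom n1 (Suc n2) n3 = denom n1 n2 n3 * (1 - fps_X ^ (2 * n2 + 2) :: 'a fps)"
  "denom n1 n2 (Suc n3) = denom n1 n2 n3 * (1 - fps_X ^ (3 * n3 + 3) :: 'a fps)"
proof -
  have "fps_X ^ k * (fps_X ^ k) ^ n = (fps_X ^ (k * n + k) :: 'a fps)" for k n
    by (simp add: power_add power_mult mult.commute)
  then show
    "denom (Suc n1) n2 n3 = denom n1 n2 n3 * (1 - fps_X ^ (n1 + 1) :: 'a fps)"
    "denom n1 (Suc n2) n3 = denom n1 n2 n3 * (1 - fps_X ^ (2 * n2 + 2) :: 'a fps)"
    "denom n1 n2 (Suc n3) = denom n1 n2 n3 * (1 - fps_X ^ (3 * n3 + 3) :: 'a fps)"
    by (simp_all add: denom_def qpoch_Suc mult_ac)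
qed

text \<open>A quadratic polynomial changes by a linear one along a unit step. The comparison is made
  in the rationals, where \<open>of_nat_q_exponent\<close> removes the rounding. The linear parts
  become the index shifts in the contiguous relations.\<close>

lemma q_exponent_Suc:
  "q_exponent 1 (Suc n1) n2 n3 = q_exponent 1 n1 n2 n3 + (n1 + 2 * n2 + 3 * n3 + 1)"
  "q_exponent 1 n1 (Suc n2) n3 = q_exponent 1 n1 n2 n3 + (2 * n1 + 6 * n2 + 6 * n3 + 2)"
  "q_exponent 1 n1 n2 (Suc n3) = q_exponent 1 n1 n2 n3 + (3 * n1 + 6 * n2 + 9 * n3 + 4)"
proof -
  have "rat_of_nat (q_exponent 1 (Suc n1) n2 n3)
      = of_nat (q_exponent 1 n1 n2 n3 + (n1 + 2 * n2 + 3 * n3 + 1))"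
    by (simp add: of_nat_q_exponent Q_def lin_coeffs_def field_simps power2_eq_square)
  then show "q_exponent 1 (Suc n1) n2 n3 = q_exponent 1 n1 n2 n3 + (n1 + 2 * n2 + 3 * n3 + 1)"
    by (rule of_nat_eq_iff[THEN iffD1])
  have "rat_of_nat (q_exponent 1 n1 (Suc n2) n3)
      = of_nat (q_exponent 1 n1 n2 n3 + (2 * n1 + 6 * n2 + 6 * n3 + 2))"
    by (simp add: of_nat_q_exponent Q_def lin_coeffs_def field_simps power2_eq_square)
  then show "q_exponent 1 n1 (Suc n2) n3 = q_exponent 1 n1 n2 n3 + (2 * n1 + 6 * n2 + 6 * n3 + 2)"
    by (rule of_nat_eq_iff[THEN iffD1])
  have "rat_of_nat (q_exponent 1 n1 n2 (Suc n3))
      = of_nat (q_exponent 1 n1 n2 n3 + (3 * n1 + 6 * n2 + 9 * n3 + 4))"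
    by (simp add: of_nat_q_exponent Q_def lin_coeffs_def field_simps power2_eq_square)
  then show "q_exponent 1 n1 n2 (Suc n3) = q_exponent 1 n1 n2 n3 + (3 * n1 + 6 * n2 + 9 * n3 + 4)"
    by (rule of_nat_eq_iff[THEN iffD1])
qed

text \<open>Both sides agree after multiplication by the nonzero \<open>denom n1 n2 n3\<close>. Here
  \<open>d\<close> is the last Pochhammer factor when an index is raised, and 1 when only the row
  changes.\<close>

lemma F_coeff_transfer:
  fixes d :: "'a::field fps"
  assumes "q_exponent i m1 m2 m3 = q_exponent j n1 n2 n3 + e"
    and "denom m1 m2 m3 = denom n1 n2 n3 * d"
  shows "F_coeff i m1 m2 m3 * d = fps_X ^ e * F_coeff j n1 n2 n3"
proof -
  have "(F_coeff i m1 m2 m3 * d) * denom n1 n2 n3 = F_coeff i m1 m2 m3 * denom m1 m2 m3"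
    by (simp only: assms(2) mult_ac)
  also have "\<dots> = fps_X ^ e * fps_X ^ q_exponent j n1 n2 n3"
    unfolding F_coeff_times_denom assms(1) by (simp add: power_add mult.commute)
  also have "\<dots> = (fps_X ^ e * F_coeff j n1 n2 n3) * denom n1 n2 n3"
    by (simp only: F_coeff_times_denom mult.assoc)
  finally show ?thesis
    using denom_nonzero mult_right_cancel by blast
qed

lemmas F_coeff_Suc =
  F_coeff_transfer[OF q_exponent_Suc(1) denom_Suc(1)]
  F_coeff_transfer[OF q_exponent_Suc(2) denom_Suc(2)]
  F_coeff_transfer[OF q_exponent_Suc(3) denom_Suc(3)]

section \<open>Contiguous relations for the twisted series\<close>

text \<open>The difference of the two powers is x^k (1 - x^d), which supplies the factor that
  \<open>f\<close> needs to become x^e \<open>g\<close>. The total exponent is then split into a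
  constant part \<open>w\<close> and the new twist \<open>r\<close>.\<close>

lemma power_shift_identity:
  fixes x :: "'a::comm_ring_1"
  assumes "f * (1 - x ^ d) = x ^ e * g" and "l = k + d" and "e + k = w + r"
  shows "f * x ^ k - f * x ^ l = x ^ w * (g * x ^ r)"
proof -
  have "f * x ^ k - f * x ^ l = (f * (1 - x ^ d)) * x ^ k"
    by (simp add: assms(2) power_add algebra_simps)
  also have "\<dots> = g * x ^ (e + k)"
    by (simp add: assms(1) power_add mult_ac)
  also have "\<dots> = x ^ w * (g * x ^ r)"
    by (simp add: assms(3) power_add mult_ac)
  finally show ?thesis .
qed

text \<open>This is the family S(a, b, c) of the overview.\<close>

definition twist :: "nat \<Rightarrow> nat \<Rightarrow> nat \<Rightarrow> 'a::field fps fps" where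
  "twist a b c = triple_gf (\<lambda>n1 n2 n3. F_coeff 1 n1 n2 n3 * fps_X ^ (a * n1 + b * n2 + c * n3))"

lemma q_var_power: "q_var ^ n = fps_const (fps_X ^ n)"
  by (simp add: q_var_def fps_const_power)

text \<open>Raising a by 1 multiplies a summand by q^n1, and 1 - q^n1 is the last factor of (q;
  q)_n1, or 0 if n1 = 0. In the next two relations b rises by 2 and c by 3, to match the last
  factors 1 - q^(2 n2) and 1 - q^(3 n3).\<close>

lemma twist_step1:
  "twist a b c = twist (a + 1) b c + fps_X * q_var ^ (a + 1) * twist (a + 1) (b + 2) (c + 3)"
proof -
  have shift: "F_coeff 1 (n1 + 1) n2 n3 * fps_X ^ (a * (n1 + 1) + b * n2 + c * n3)
      - F_coeff 1 (n1 + 1) n2 n3 * fps_X ^ ((a + 1) * (n1 + 1) + b * n2 + c * n3)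
    = fps_X ^ (a + 1) * (F_coeff 1 n1 n2 n3
        * fps_X ^ ((a + 1) * n1 + (b + 2) * n2 + (c + 3) * n3) :: 'a fps)" for n1 n2 n3
    by (rule power_shift_identity[OF F_coeff_Suc(1)[unfolded Suc_eq_plus1]])
      (simp_all add: algebra_simps)
  \<comment> \<open>The unevaluated exponent of x lets unification read off the shift (k1, k2, k3) =
    (1, 0, 0).\<close>
  have "twist a b c = twist (a + 1) b c
      + fps_X ^ (1 + 2 * 0 + 3 * 0) * fps_const (fps_X ^ (a + 1))
        * (twist (a + 1) (b + 2) (c + 3) :: 'a fps fps)"
    unfolding twist_def
    by (rule triple_gf_eq_add_shift) (simp, simp only: add_0_right shift)
  then show ?thesis
    by (simp only: q_var_power mult_0_right mult_1_right add_0_left add_0_right power_one_right)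
qed

lemma twist_step2:
  "twist a b c = twist a (b + 2) c + fps_X\<^sup>2 * q_var ^ (b + 2) * twist (a + 2) (b + 6) (c + 6)"
proof -
  have shift: "F_coeff 1 n1 (n2 + 1) n3 * fps_X ^ (a * n1 + b * (n2 + 1) + c * n3)
      - F_coeff 1 n1 (n2 + 1) n3 * fps_X ^ (a * n1 + (b + 2) * (n2 + 1) + c * n3)
    = fps_X ^ (b + 2) * (F_coeff 1 n1 n2 n3
        * fps_X ^ ((a + 2) * n1 + (b + 6) * n2 + (c + 6) * n3) :: 'a fps)" for n1 n2 n3
    by (rule power_shift_identity[OF F_coeff_Suc(2)[unfolded Suc_eq_plus1]])
      (simp_all add: algebra_simps)
  have "twist a b c = twist a (b + 2) c
      + fps_X ^ (0 + 2 * 1 + 3 * 0) * fps_const (fps_X ^ (b + 2))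
        * (twist (a + 2) (b + 6) (c + 6) :: 'a fps fps)"
    unfolding twist_def
    by (rule triple_gf_eq_add_shift) (simp, simp only: add_0_right shift)
  then show ?thesis
    by (simp only: q_var_power mult_0_right mult_1_right add_0_left add_0_right power_one_right)
qed

lemma twist_step3:
  "twist a b c = twist a b (c + 3) + fps_X ^ 3 * q_var ^ (c + 4) * twist (a + 3) (b + 6) (c + 9)"
proof -
  have shift: "F_coeff 1 n1 n2 (n3 + 1) * fps_X ^ (a * n1 + b * n2 + c * (n3 + 1))
      - F_coeff 1 n1 n2 (n3 + 1) * fps_X ^ (a * n1 + b * n2 + (c + 3) * (n3 + 1))
    = fps_X ^ (c + 4) * (F_coeff 1 n1 n2 n3
        * fps_X ^ ((a + 3) * n1 + (b + 6) * n2 + (c + 9) * n3) :: 'a fps)" for n1 n2 n3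
    by (rule power_shift_identity[OF F_coeff_Suc(3)[unfolded Suc_eq_plus1]])
      (simp_all add: algebra_simps)
  have "twist a b c = twist a b (c + 3)
      + fps_X ^ (0 + 2 * 0 + 3 * 1) * fps_const (fps_X ^ (c + 4))
        * (twist (a + 3) (b + 6) (c + 9) :: 'a fps fps)"
    unfolding twist_def
    by (rule triple_gf_eq_add_shift) (simp, simp only: add_0_right shift)
  then show ?thesis
    by (simp only: q_var_power mult_0_right mult_1_right add_0_left add_0_right power_one_right)
qed

section \<open>The matrix identity\<close>

text \<open>Replacing x by x q^m multiplies a summand by q^(m (n1 + 2 n2 + 3 n3)), which adds (m,
  2m, 3m) to the twist. The triple (a, b, c) is the excess of the linear form of row i over that of
  row 1.\<close>

lemma F_eq_twist:
  assumes "lin_coeffs i = (1/2 + of_nat a, -1 + of_nat b, -1/2 + of_nat c)"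
  shows "F i (fps_X * q_var ^ m) = (twist (a + m) (b + 2 * m) (c + 3 * m) :: 'a::field fps fps)"
proof (rule fps_ext)
  fix N
  have e: "q_exponent i n1 n2 n3 = q_exponent 1 n1 n2 n3 + (a * n1 + b * n2 + c * n3)" for n1 n2 n3
  proof -
    have "rat_of_nat (q_exponent i n1 n2 n3)
        = of_nat (q_exponent 1 n1 n2 n3 + (a * n1 + b * n2 + c * n3))"
      unfolding of_nat_add of_nat_q_exponent assms
      by (simp add: lin_coeffs_def field_simps)
    then show ?thesis by (rule of_nat_eq_iff[THEN iffD1])
  qed
  \<comment> \<open>The indices, hence the denominators, coincide, so the transfer factor is
    1.\<close>
  have c: "F_coeff i n1 n2 n3 = (fps_X ^ (a * n1 + b * n2 + c * n3) * F_coeff 1 n1 n2 n3 :: 'a fps)"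
    for n1 n2 n3
    using F_coeff_transfer[OF e[of n1 n2 n3], of 1] by simp
  show "fps_nth (F i (fps_X * q_var ^ m)) N
    = fps_nth (twist (a + m) (b + 2 * m) (c + 3 * m) :: 'a fps fps) N"
    unfolding q_var_power F_nth twist_def triple_gf_nth triples_def[symmetric]
  proof (rule sum.cong[OF refl])
    fix t assume "t \<in> triples N"
    then obtain n1 n2 n3 where t: "t = (n1, n2, n3)" and N: "n1 + 2 * n2 + 3 * n3 = N"
      by (cases t) auto
    have "a * n1 + b * n2 + c * n3 + m * N
        = (a + m) * n1 + (b + 2 * m) * n2 + (c + 3 * m) * n3"
      by (simp add: N[symmetric] algebra_simps)
    then show "(case t of (n1, n2, n3) \<Rightarrow> F_coeff i n1 n2 n3 * (fps_X ^ m) ^ N)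
      = (case t of (n1, n2, n3) \<Rightarrow> F_coeff 1 n1 n2 n3
          * (fps_X :: 'a fps) ^ ((a + m) * n1 + (b + 2 * m) * n2 + (c + 3 * m) * n3))"
      unfolding t split c power_mult[symmetric] by (simp add: mult_ac flip: power_add)
  qed
qed

text \<open>Vectors are indexed from 0, so the rows 1-6, 7-13, 14-21, 22-23 end before 6, 13, 21,
  23. The left side of the identity uses m = 0 and the right side m = 3.\<close>

lemma F_vec_index:
  assumes "i < 23"
  shows "F_vec (fps_X * q_var ^ m) $ i =
    (if i < 6 then twist m (2 * m) (3 * m)
     else if i < 13 then twist (1 + m) (2 + 2 * m) (3 + 3 * m)
     else if i < 21 then twist (1 + m) (4 + 2 * m) (6 + 3 * m)
     else twist (2 + m) (4 + 2 * m) (6 + 3 * m))"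
  using assms F_eq_twist[of "i + 1" 0 0 0 m] F_eq_twist[of "i + 1" 1 2 3 m]
    F_eq_twist[of "i + 1" 1 4 6 m] F_eq_twist[of "i + 1" 2 4 6 m]
  by (auto simp: F_vec_def lin_coeffs_def)

lemma sum_lessThan_23:
  fixes f :: "nat \<Rightarrow> 'a::comm_monoid_add"
  shows "(\<Sum>j<23. f j) = f 0 + f 1 + f 2 + f 3 + f 4 + f 5 + f 6 + f 7 + f 8 + f 9
    + f 10 + f 11 + f 12 + f 13 + f 14 + f 15 + f 16 + f 17 + f 18 + f 19 + f 20 + f 21
    + f 22"
  by (simp add: eval_nat_numeral add.assoc)

theorem theorem4p4:
  "F_vec (fps_X :: 'a::field fps fps) = A_mat * W_mat fps_X *\<^sub>v F_vec (fps_X * q_var ^ 3)"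
proof (rule eq_vecI)
  let ?w = "\<lambda>j. W_mat fps_X $$ (j, j) :: 'a fps fps"
  let ?G = "F_vec (fps_X * q_var ^ 3) :: 'a fps fps vec"
  show "dim_vec (F_vec (fps_X :: 'a fps fps)) = dim_vec (A_mat * W_mat fps_X *\<^sub>v ?G)"
    by (simp add: F_vec_def A_mat_def)
  fix i assume "i < dim_vec (A_mat * W_mat fps_X *\<^sub>v ?G)"
  then have i: "i < 23" by (simp add: A_mat_def)
  \<comment> \<open>A diagonal right factor scales the columns of \<open>A_mat\<close>, so each row
    is a weighted sum over the columns in \<open>A_cols\<close>.\<close>
  have row: "(A_mat * W_mat fps_X *\<^sub>v ?G) $ i
      = (\<Sum>j<23. (if j + 1 \<in> A_cols (i + 1) then ?w j * ?G $ j else 0))"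
  proof -
    have "A_mat * W_mat fps_X
        = mat 23 23 (\<lambda>(i, j). if j + 1 \<in> A_cols (i + 1) then ?w j else 0)"
      unfolding W_mat_def Let_def
      by (subst mat_diag_mult_right[of _ 23])
        (auto simp: A_mat_def mat_diag_def intro!: eq_matI)
    then show ?thesis
      using i by (auto simp: scalar_prod_def F_vec_def atLeast0LessThan intro!: sum.cong)
  qed
  have lhs: "F_vec (fps_X :: 'a fps fps) $ i =
    (if i < 6 then twist 0 0 0 else if i < 13 then twist 1 2 3
     else if i < 21 then twist 1 4 6 else twist 2 4 6)"
    using F_vec_index[OF i, of 0, where ?'a = 'a] by simp
  have cols: "A_cols (i + 1) =
    (if i < 6 then {1..23} else if i < 13 then {1, 2, 7, 8, 9, 10, 14, 15, 16, 17, 22}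
     else if i < 21 then {1, 2, 7, 8, 14, 15, 16, 22} else {1, 7, 14, 15, 22})"
    using i by (auto simp: A_cols_def)
  note rel = contiguous_relations_iterated[of "twist :: _ \<Rightarrow> _ \<Rightarrow> _ \<Rightarrow> 'a fps fps" fps_X q_var,
    OF twist_step1 twist_step2 twist_step3, unfolded One_nat_def]
  \<comment> \<open>The four blocks of equal rows correspond to the four equations in
    \<open>rel\<close>.\<close>
  consider "i < 6" | "6 \<le> i" "i < 13" | "13 \<le> i" "i < 21" | "21 \<le> i"
    by linarith
  then show "F_vec fps_X $ i = (A_mat * W_mat fps_X *\<^sub>v ?G) $ i"
    unfolding row lhs cols sum_lessThan_23
    by cases (simp_all add: F_vec_index W_mat_def mat_diag_def rel)
qed

end
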